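(* Let $\mathcal{E}$ be a nonzero separable complex Hilbert space, let $T \in B(l^2_{\mathcal{E}}(\mathbb{N}))$, let $n \geq 0$ be an integer, and let $$R_{T,n} = \begin{pmatrix} (S^* )^n & T \\ 0 & S^n \end{pmatrix}$$ acting on $l^2_{\mathcal{E}}(\mathbb{N}) \oplus l^2_{\mathcal{E}}(\mathbb{N})$, where $S$ is the unilateral shift on $l^2_{\mathcal{E}}(\mathbb{N})$. Then $$\left\| R_{T,n} \right\| = \frac{\|T\| + \sqrt{\|T\|^2 + 4}}{2}.$$
   Context: $l^2_{\mathcal{E}}(\mathbb{N})$ is the Hilbert space of square-summable sequences $(a_0,a_1,a_2,\ldots)$ with entries in $\mathcal{E}$, and $B(\mathcal{H})$ denotes the bounded linear operators on a Hilbert space $\mathcal{H}$, with $\|\cdot\|$ the operator norm. The unilateral shift $S$ on $l^2_{\mathcal{E}}(\mathbb{N})$ is $S(a_0,a_1,a_2,\ldots) = (0,a_0,a_1,\ldots)$. The operator $R_{T,n}$ is called a Foguel operator of order $n$. *)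

theory Defs
  imports "HOL-Analysis.Analysis"
begin

text \<open>Any complex inner product space is an instance: its norm is that of the real inner product
  \<open>Re (cinner x y)\<close>, so the library's real normed space notions apply. Positivity of
  \<open>cinner\<close> comes from the superclass.\<close>

class complex_inner = real_inner +
  fixes scaleC :: "complex \<Rightarrow> 'a \<Rightarrow> 'a" (infixr \<open>*\<^sub>C\<close> 75)
    and cinner :: "'a \<Rightarrow> 'a \<Rightarrow> complex"
  assumes scaleC_add_right: "c *\<^sub>C (x + y) = c *\<^sub>C x + c *\<^sub>C y"
    and scaleC_add_left: "(c + d) *\<^sub>C x = c *\<^sub>C x + d *\<^sub>C x"
    and scaleC_scaleC: "c *\<^sub>C (d *\<^sub>C x) = (c * d) *\<^sub>C x"
    and scaleR_scaleC: "r *\<^sub>R x = complex_of_real r *\<^sub>C x"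
    and cinner_commute: "cinner x y = cnj (cinner y x)"
    and cinner_add_left: "cinner (x + y) z = cinner x z + cinner y z"
    and cinner_scaleC_left: "cinner (c *\<^sub>C x) y = c * cinner x y"
    and Re_cinner: "Re (cinner x y) = inner x y"

class chilbert_space = complex_inner + complete_space

instantiation complex :: chilbert_space
begin

definition scaleC_complex :: "complex \<Rightarrow> complex \<Rightarrow> complex" where
  "scaleC_complex c z = c * z"

definition cinner_complex :: "complex \<Rightarrow> complex \<Rightarrow> complex" where
  "cinner_complex z w = z * cnj w"

instance
  by standard
    (simp_all add: scaleC_complex_def cinner_complex_def scaleR_conv_of_real inner_complex_def
      algebra_simps)

end

lemma cinner_self: "cinner x x = complex_of_real ((norm x)\<^sup>2)"
proof (rule complex_eqI)
  show "Re (cinner x x) = Re (complex_of_real ((norm x)\<^sup>2))"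
    by (simp add: Re_cinner power2_norm_eq_inner)
  have "Im (cinner x x) = - Im (cinner x x)"
    by (metis cinner_commute cnj.simps(2))
  then show "Im (cinner x x) = Im (complex_of_real ((norm x)\<^sup>2))"
    by simp
qed

lemma cinner_scaleC_right: "cinner x (c *\<^sub>C y) = cnj c * cinner x y"
  by (metis cinner_commute cinner_scaleC_left complex_cnj_mult)

lemma norm_scaleC: "norm (c *\<^sub>C x) = cmod c * norm x"
proof -
  have "complex_of_real ((norm (c *\<^sub>C x))\<^sup>2) = c * cnj c * cinner x x"
    by (simp add: cinner_self[symmetric] cinner_scaleC_left cinner_scaleC_right mult.assoc
        del: of_real_power)
  also have "\<dots> = complex_of_real ((cmod c * norm x)\<^sup>2)"
    by (simp only: cinner_self complex_norm_square[symmetric] power_mult_distrib of_real_mult)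
  finally have "complex_of_real ((norm (c *\<^sub>C x))\<^sup>2) = complex_of_real ((cmod c * norm x)\<^sup>2)" .
  then have "(norm (c *\<^sub>C x))\<^sup>2 = (cmod c * norm x)\<^sup>2"
    by (simp only: of_real_eq_iff)
  then show ?thesis
    by (simp add: power2_eq_iff_nonneg)
qed

lemma cmod_cinner_le: "cmod (cinner x y) \<le> norm x * norm y"
proof (cases "cinner x y = 0")
  case False
  define u where "u = cnj (cinner x y) / cmod (cinner x y)"
  have "cmod u = 1"
    using False by (simp add: u_def norm_divide)
  have "u * cinner x y = complex_of_real (cmod (cinner x y))"
    using False by (simp add: u_def mult.commute[of "cnj _"] complex_norm_square[symmetric]
        power2_eq_square)
  then have "cmod (cinner x y) = inner (u *\<^sub>C x) y"
    by (metis Re_cinner cinner_scaleC_left Re_complex_of_real)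
  also have "\<dots> \<le> norm (u *\<^sub>C x) * norm y"
    by (rule norm_cauchy_schwarz)
  finally show ?thesis
    by (simp add: norm_scaleC \<open>cmod u = 1\<close>)
qed simp

definition bounded_clinear :: "('a::complex_inner \<Rightarrow> 'b::complex_inner) \<Rightarrow> bool" where
  "bounded_clinear f \<longleftrightarrow> bounded_linear f \<and> (\<forall>c x. f (c *\<^sub>C x) = c *\<^sub>C f x)"

definition cadjoint :: "('a::complex_inner \<Rightarrow> 'b::complex_inner) \<Rightarrow> 'b \<Rightarrow> 'a" where
  "cadjoint f = (THE g. \<forall>x y. cinner (f x) y = cinner x (g y))"

lemma cadjoint_eqI:
  fixes f :: "'a::complex_inner \<Rightarrow> 'b::complex_inner"
  assumes "\<And>x y. cinner (f x) y = cinner x (g y)"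
  shows "cadjoint f = g"
  unfolding cadjoint_def
proof (rule the_equality)
  show "\<forall>x y. cinner (f x) y = cinner x (g y)"
    using assms by blast
  fix h assume h: "\<forall>x y. cinner (f x) y = cinner x (h y)"
  show "h = g"
  proof
    fix y
    have "inner x (h y) = inner x (g y)" for x
      using h assms by (metis Re_cinner)
    then show "h y = g y"
      by (metis inner_commute vector_eq_rdot)
  qed
qed

text \<open>The library already gives \<open>'a \<times> 'b\<close> the sum of the two inner products, and
  hence the norm \<open>sqrt ((norm x)\<^sup>2 + (norm y)\<^sup>2)\<close>.\<close>

instantiation prod :: (complex_inner, complex_inner) complex_inner
begin

definition scaleC_prod_def: "c *\<^sub>C z = (c *\<^sub>C fst z, c *\<^sub>C snd z)"

definition cinner_prod_def: "cinner z w = cinner (fst z) (fst w) + cinner (snd z) (snd w)"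

instance
  by standard
    (simp_all add: scaleC_prod_def cinner_prod_def scaleC_add_right scaleC_add_left scaleC_scaleC
      scaleR_scaleC cinner_add_left cinner_scaleC_left Re_cinner inner_prod_def prod_eq_iff
      distrib_left cinner_commute[symmetric])

end

instance prod :: (chilbert_space, chilbert_space) chilbert_space
  by standard

definition block_op ::
  "('a \<Rightarrow> 'c) \<Rightarrow> ('b \<Rightarrow> 'c) \<Rightarrow> ('a \<Rightarrow> 'd) \<Rightarrow> ('b \<Rightarrow> 'd) \<Rightarrow> 'a \<times> 'b \<Rightarrow> 'c::plus \<times> 'd::plus" where
  "block_op A B C D = (\<lambda>(x, y). (A x + B y, C x + D y))"

lemma summable_norm_sq_add:
  fixes a b :: "nat \<Rightarrow> 'a::real_normed_vector"
  assumes "summable (\<lambda>k. (norm (a k))\<^sup>2)" "summable (\<lambda>k. (norm (b k))\<^sup>2)"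
  shows "summable (\<lambda>k. (norm (a k + b k))\<^sup>2)"
proof (rule summable_comparison_test')
  show "summable (\<lambda>k. 2 * (norm (a k))\<^sup>2 + 2 * (norm (b k))\<^sup>2)"
    using assms by (intro summable_add summable_mult)
  fix k
  have "(norm (a k + b k))\<^sup>2 \<le> (norm (a k) + norm (b k))\<^sup>2"
    by (intro power_mono norm_triangle_ineq) simp
  also have "\<dots> \<le> 2 * (norm (a k))\<^sup>2 + 2 * (norm (b k))\<^sup>2"
    using sum_squares_bound[of "norm (a k)" "norm (b k)"] by (simp add: power2_sum)
  finally show "norm ((norm (a k + b k))\<^sup>2) \<le> 2 * (norm (a k))\<^sup>2 + 2 * (norm (b k))\<^sup>2"
    by simp
qed

lemma summable_norm_sq_prod:
  fixes a b :: "nat \<Rightarrow> 'a::real_normed_vector"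
  assumes "summable (\<lambda>k. (norm (a k))\<^sup>2)" "summable (\<lambda>k. (norm (b k))\<^sup>2)"
  shows "summable (\<lambda>k. norm (a k) * norm (b k))"
proof (rule summable_comparison_test')
  show "summable (\<lambda>k. (norm (a k))\<^sup>2 + (norm (b k))\<^sup>2)"
    using assms by (rule summable_add)
  fix k
  have "2 * (norm (a k) * norm (b k)) \<le> (norm (a k))\<^sup>2 + (norm (b k))\<^sup>2"
    using sum_squares_bound[of "norm (a k)" "norm (b k)"] by simp
  moreover have "0 \<le> norm (a k) * norm (b k)"
    by simp
  ultimately have "norm (a k) * norm (b k) \<le> (norm (a k))\<^sup>2 + (norm (b k))\<^sup>2"
    by linarith
  then show "norm (norm (a k) * norm (b k)) \<le> (norm (a k))\<^sup>2 + (norm (b k))\<^sup>2"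
    by simp
qed

typedef (overloaded) 'e l2 = "{a :: nat \<Rightarrow> 'e::complex_inner. summable (\<lambda>k. (norm (a k))\<^sup>2)}"
  morphisms l2_nth Abs_l2
  by (rule exI[of _ "\<lambda>_. 0"]) simp

setup_lifting type_definition_l2

lemma l2_eqI: "(\<And>k. l2_nth a k = l2_nth b k) \<Longrightarrow> a = b"
  by (metis ext l2_nth_inject)

lemma summable_l2: "summable (\<lambda>k. (norm (l2_nth a k))\<^sup>2)"
  using l2_nth[of a] by simp

lemma summable_cinner_l2: "summable (\<lambda>k. cinner (l2_nth a k) (l2_nth b k))"
  by (rule summable_comparison_test'[OF summable_norm_sq_prod[OF summable_l2[of a] summable_l2[of b]]])
    (rule cmod_cinner_le)

lemma summable_inner_l2: "summable (\<lambda>k. inner (l2_nth a k) (l2_nth b k))"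
  by (rule summable_comparison_test'[OF summable_norm_sq_prod[OF summable_l2[of a] summable_l2[of b]]])
    (simp add: Cauchy_Schwarz_ineq2)

instantiation l2 :: (complex_inner) real_vector
begin

lift_definition zero_l2 :: "'a l2" is "\<lambda>_. 0"
  by simp

lift_definition plus_l2 :: "'a l2 \<Rightarrow> 'a l2 \<Rightarrow> 'a l2" is "\<lambda>a b k. a k + b k"
  by (rule summable_norm_sq_add)

lift_definition uminus_l2 :: "'a l2 \<Rightarrow> 'a l2" is "\<lambda>a k. - a k"
  by simp

lift_definition minus_l2 :: "'a l2 \<Rightarrow> 'a l2 \<Rightarrow> 'a l2" is "\<lambda>a b k. a k - b k"
  subgoal for a b
    using summable_norm_sq_add[of a "\<lambda>k. - b k"] by simp
  done

lift_definition scaleR_l2 :: "real \<Rightarrow> 'a l2 \<Rightarrow> 'a l2" is "\<lambda>r a k. r *\<^sub>R a k"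
  by (simp add: power_mult_distrib summable_mult)

instance
  by standard (transfer; simp add: fun_eq_iff algebra_simps)+

end

lemma norm_sq_triangle:
  fixes a b :: "nat \<Rightarrow> 'a::real_normed_vector"
  assumes a: "summable (\<lambda>k. (norm (a k))\<^sup>2)" and b: "summable (\<lambda>k. (norm (b k))\<^sup>2)"
  shows "sqrt (\<Sum>k. (norm (a k + b k))\<^sup>2) \<le> sqrt (\<Sum>k. (norm (a k))\<^sup>2) + sqrt (\<Sum>k. (norm (b k))\<^sup>2)"
    (is "_ \<le> ?A + ?B")
proof (rule real_le_lsqrt)
  have le: "L2_set (\<lambda>k. norm (c k)) {..<N} \<le> sqrt (\<Sum>k. (norm (c k))\<^sup>2)"
    if "summable (\<lambda>k. (norm (c k))\<^sup>2)" for c :: "nat \<Rightarrow> 'a" and N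
    unfolding L2_set_def using that by (intro real_sqrt_le_mono sum_le_suminf) auto
  have "(\<Sum>k<N. (norm (a k + b k))\<^sup>2) \<le> (?A + ?B)\<^sup>2" for N
  proof -
    have "L2_set (\<lambda>k. norm (a k + b k)) {..<N} \<le> L2_set (\<lambda>k. norm (a k) + norm (b k)) {..<N}"
      by (intro L2_set_mono norm_triangle_ineq) simp
    also have "\<dots> \<le> L2_set (\<lambda>k. norm (a k)) {..<N} + L2_set (\<lambda>k. norm (b k)) {..<N}"
      by (rule L2_set_triangle_ineq)
    also have "\<dots> \<le> ?A + ?B"
      by (intro add_mono le a b)
    finally have "sqrt (\<Sum>k<N. (norm (a k + b k))\<^sup>2) \<le> ?A + ?B"
      by (simp add: L2_set_def)
    then show ?thesis
      by (rule sqrt_le_D)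
  qed
  then show "(\<Sum>k. (norm (a k + b k))\<^sup>2) \<le> (?A + ?B)\<^sup>2"
    by (intro suminf_le_const summable_norm_sq_add a b)
qed (intro add_nonneg_nonneg real_sqrt_ge_zero suminf_nonneg a b; simp)

instantiation l2 :: (complex_inner) real_normed_vector
begin

definition norm_l2 :: "'a l2 \<Rightarrow> real" where
  "norm_l2 a = sqrt (\<Sum>k. (norm (l2_nth a k))\<^sup>2)"

definition dist_l2 :: "'a l2 \<Rightarrow> 'a l2 \<Rightarrow> real" where
  "dist_l2 a b = norm (a - b)"

definition sgn_l2 :: "'a l2 \<Rightarrow> 'a l2" where
  "sgn_l2 a = a /\<^sub>R norm a"

definition uniformity_l2 :: "('a l2 \<times> 'a l2) filter" where
  "uniformity_l2 = (INF e\<in>{0 <..}. principal {(a, b). dist a b < e})"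

definition open_l2 :: "'a l2 set \<Rightarrow> bool" where
  "open_l2 U \<longleftrightarrow> (\<forall>x\<in>U. eventually (\<lambda>(x', y). x' = x \<longrightarrow> y \<in> U) uniformity)"

instance
proof
  fix a b :: "'a l2" and r :: real and U :: "'a l2 set"
  show "dist a b = norm (a - b)" by (rule dist_l2_def)
  show "sgn a = a /\<^sub>R norm a" by (rule sgn_l2_def)
  show "uniformity = (INF e\<in>{0 <..}. principal {(a, b :: 'a l2). dist a b < e})"
    by (rule uniformity_l2_def)
  show "open U \<longleftrightarrow> (\<forall>x\<in>U. eventually (\<lambda>(x', y). x' = x \<longrightarrow> y \<in> U) uniformity)"
    by (rule open_l2_def)
  show "norm a = 0 \<longleftrightarrow> a = 0"
  proof
    assume "norm a = 0"
    then have "(norm (l2_nth a k))\<^sup>2 = 0" for k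
      using suminf_eq_zero_iff[OF summable_l2[of a]] by (simp add: norm_l2_def)
    then show "a = 0"
      by (intro l2_eqI) (simp add: zero_l2.rep_eq)
  qed (simp add: norm_l2_def zero_l2.rep_eq)
  show "norm (a + b) \<le> norm a + norm b"
    using norm_sq_triangle[OF summable_l2[of a] summable_l2[of b]]
    by (simp add: norm_l2_def plus_l2.rep_eq)
  show "norm (r *\<^sub>R a) = \<bar>r\<bar> * norm a"
    using suminf_mult[OF summable_l2[of a], of "r\<^sup>2"]
    by (simp add: norm_l2_def scaleR_l2.rep_eq power_mult_distrib real_sqrt_mult)
qed

end

instantiation l2 :: (complex_inner) real_inner
begin

definition inner_l2 :: "'a l2 \<Rightarrow> 'a l2 \<Rightarrow> real" where
  "inner a b = (\<Sum>k. inner (l2_nth a k) (l2_nth b k))"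

instance
proof
  fix a b d :: "'a l2" and r :: real
  show norm: "norm a = sqrt (inner a a)" for a :: "'a l2"
    by (simp add: norm_l2_def inner_l2_def power2_norm_eq_inner)
  show "inner a b = inner b a"
    by (simp add: inner_l2_def inner_commute)
  show "inner (a + b) d = inner a d + inner b d"
    using suminf_add[OF summable_inner_l2[of a d] summable_inner_l2[of b d]]
    by (simp add: inner_l2_def plus_l2.rep_eq inner_add_left)
  show "inner (r *\<^sub>R a) b = r * inner a b"
    using suminf_mult[OF summable_inner_l2[of a b], of r]
    by (simp add: inner_l2_def scaleR_l2.rep_eq)
  show "0 \<le> inner a a"
    unfolding inner_l2_def by (intro suminf_nonneg summable_inner_l2) simp
  show "inner a a = 0 \<longleftrightarrow> a = 0"
    using norm[of a] by (metis norm_eq_zero real_sqrt_eq_zero_cancel_iff)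
qed

end

instantiation l2 :: (complex_inner) complex_inner
begin

lift_definition scaleC_l2 :: "complex \<Rightarrow> 'a l2 \<Rightarrow> 'a l2" is "\<lambda>c a k. c *\<^sub>C a k"
  by (simp add: norm_scaleC power_mult_distrib summable_mult)

definition cinner_l2 :: "'a l2 \<Rightarrow> 'a l2 \<Rightarrow> complex" where
  "cinner a b = (\<Sum>k. cinner (l2_nth a k) (l2_nth b k))"

instance
proof
  fix a b d :: "'a l2" and r :: real and c c' :: complex
  show "c *\<^sub>C (a + b) = c *\<^sub>C a + c *\<^sub>C b"
    by transfer (simp add: scaleC_add_right)
  show "(c + c') *\<^sub>C a = c *\<^sub>C a + c' *\<^sub>C a"
    by transfer (simp add: scaleC_add_left)
  show "c *\<^sub>C (c' *\<^sub>C a) = (c * c') *\<^sub>C a"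
    by transfer (simp add: scaleC_scaleC)
  show "r *\<^sub>R a = complex_of_real r *\<^sub>C a"
    by transfer (simp add: scaleR_scaleC)
  show "cinner a b = cnj (cinner b a)"
  proof -
    have "(\<lambda>k. cnj (cinner (l2_nth b k) (l2_nth a k))) sums cnj (cinner b a)"
      unfolding sums_cnj cinner_l2_def by (rule summable_sums[OF summable_cinner_l2])
    then have "(\<lambda>k. cinner (l2_nth a k) (l2_nth b k)) sums cnj (cinner b a)"
      by (simp add: cinner_commute[symmetric])
    then show ?thesis
      unfolding cinner_l2_def[of a b] by (rule sums_unique[symmetric])
  qed
  show "cinner (a + b) d = cinner a d + cinner b d"
    using suminf_add[OF summable_cinner_l2[of a d] summable_cinner_l2[of b d]]
    by (simp add: cinner_l2_def plus_l2.rep_eq cinner_add_left)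
  show "cinner (c *\<^sub>C a) b = c * cinner a b"
    using suminf_mult[OF summable_cinner_l2[of a b], of c]
    by (simp add: cinner_l2_def scaleC_l2.rep_eq cinner_scaleC_left)
  show "Re (cinner a b) = inner a b"
    by (simp add: cinner_l2_def inner_l2_def Re_suminf[OF summable_cinner_l2] Re_cinner)
qed

end

instance l2 :: (chilbert_space) chilbert_space
proof
  fix X :: "nat \<Rightarrow> 'a l2"
  assume X: "Cauchy X"
  have sum_le: "(\<Sum>k<N. (norm (l2_nth a k))\<^sup>2) \<le> (norm a)\<^sup>2" for a :: "'a l2" and N
    unfolding norm_l2_def
    by (simp add: suminf_nonneg summable_l2 sum_le_suminf)
  have nth_le: "norm (l2_nth a k) \<le> norm a" for a :: "'a l2" and k
  proof (rule power2_le_imp_le)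
    have "(norm (l2_nth a k))\<^sup>2 \<le> (\<Sum>i<Suc k. (norm (l2_nth a i))\<^sup>2)"
      by (rule member_le_sum) auto
    also have "\<dots> \<le> (norm a)\<^sup>2"
      by (rule sum_le)
    finally show "(norm (l2_nth a k))\<^sup>2 \<le> (norm a)\<^sup>2" .
  qed simp
  have "Cauchy (\<lambda>n. l2_nth (X n) k)" for k
  proof (rule CauchyI)
    fix e :: real assume "0 < e"
    then obtain M where "\<forall>m\<ge>M. \<forall>n\<ge>M. norm (X m - X n) < e"
      using CauchyD[OF X] by blast
    then show "\<exists>M. \<forall>m\<ge>M. \<forall>n\<ge>M. norm (l2_nth (X m) k - l2_nth (X n) k) < e"
      using nth_le by (metis minus_l2.rep_eq order_le_less_trans)
  qed
  then obtain L where L: "\<And>k. (\<lambda>n. l2_nth (X n) k) \<longlonglongrightarrow> L k"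
    unfolding Cauchy_convergent_iff convergent_def by metis
  have tail: "\<exists>M. \<forall>m\<ge>M. \<forall>N. (\<Sum>k<N. (norm (l2_nth (X m) k - L k))\<^sup>2) \<le> e\<^sup>2" if "0 < e" for e
  proof -
    obtain M where M: "\<forall>m\<ge>M. \<forall>n\<ge>M. norm (X m - X n) < e"
      using CauchyD[OF X \<open>0 < e\<close>] by blast
    have "(\<Sum>k<N. (norm (l2_nth (X m) k - L k))\<^sup>2) \<le> e\<^sup>2" if "m \<ge> M" for m N
    proof (rule tendsto_upperbound)
      show "(\<lambda>n. \<Sum>k<N. (norm (l2_nth (X m) k - l2_nth (X n) k))\<^sup>2)
          \<longlonglongrightarrow> (\<Sum>k<N. (norm (l2_nth (X m) k - L k))\<^sup>2)"
        by (intro tendsto_intros L)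
      have "(\<Sum>k<N. (norm (l2_nth (X m) k - l2_nth (X n) k))\<^sup>2) \<le> e\<^sup>2" if "n \<ge> M" for n
      proof -
        have "norm (X m - X n) \<le> e"
          using M \<open>m \<ge> M\<close> that by (simp add: less_imp_le)
        then have "(norm (X m - X n))\<^sup>2 \<le> e\<^sup>2"
          by (intro power_mono) auto
        then show ?thesis
          using sum_le[where a = "X m - X n" and N = N] by (simp add: minus_l2.rep_eq)
      qed
      then show "\<forall>\<^sub>F n in sequentially. (\<Sum>k<N. (norm (l2_nth (X m) k - l2_nth (X n) k))\<^sup>2) \<le> e\<^sup>2"
        unfolding eventually_sequentially by blast
    qed simp
    then show ?thesis by blast
  qed
  have summ: "summable (\<lambda>k. (norm (l2_nth (X m) k - L k))\<^sup>2)"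
    if "\<forall>N. (\<Sum>k<N. (norm (l2_nth (X m) k - L k))\<^sup>2) \<le> e" for m e
    using that by (intro bounded_imp_summable[where B = e]) (auto simp: lessThan_Suc_atMost[symmetric]
        simp del: sum.lessThan_Suc)
  obtain M where "\<forall>N. (\<Sum>k<N. (norm (l2_nth (X M) k - L k))\<^sup>2) \<le> 1\<^sup>2"
    using tail[of 1] by auto
  then have "summable (\<lambda>k. (norm (L k - l2_nth (X M) k))\<^sup>2)"
    using summ by (simp add: norm_minus_commute)
  from summable_norm_sq_add[OF this summable_l2[of "X M"]]
  have "summable (\<lambda>k. (norm (L k))\<^sup>2)"
    by simp
  then obtain l where l: "l2_nth l = L"
    using Abs_l2_inverse by blast
  have "X \<longlonglongrightarrow> l"
  proof (rule LIMSEQ_I)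
    fix e :: real assume "0 < e"
    then obtain M where M: "\<forall>m\<ge>M. \<forall>N. (\<Sum>k<N. (norm (l2_nth (X m) k - L k))\<^sup>2) \<le> (e/2)\<^sup>2"
      using tail[of "e/2"] by auto
    have "norm (X m - l) < e" if "m \<ge> M" for m
    proof -
      have "(\<Sum>k. (norm (l2_nth (X m) k - L k))\<^sup>2) \<le> (e/2)\<^sup>2"
        using M that by (intro suminf_le_const summ) blast+
      then have "(\<Sum>k. (norm (l2_nth (X m - l) k))\<^sup>2) \<le> (e/2)\<^sup>2"
        by (simp add: minus_l2.rep_eq l)
      then have "norm (X m - l) \<le> e/2"
        unfolding norm_l2_def using \<open>0 < e\<close> by (intro real_le_lsqrt) (simp_all add: suminf_nonneg summable_l2)
      then show ?thesis
        using \<open>0 < e\<close> by simp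
    qed
    then show "\<exists>M. \<forall>m\<ge>M. norm (X m - l) < e" by blast
  qed
  then show "convergent X"
    by (rule convergentI)
qed

lift_definition shift :: "'e::complex_inner l2 \<Rightarrow> 'e l2"
  is "\<lambda>a k. case k of 0 \<Rightarrow> 0 | Suc j \<Rightarrow> a j"
  by (subst summable_Suc_iff[symmetric]) simp

lift_definition backward_shift :: "'e::complex_inner l2 \<Rightarrow> 'e l2" is "\<lambda>a k. a (Suc k)"
  by (simp add: summable_Suc_iff[where f = "\<lambda>k. (norm (_ k))\<^sup>2"])

text \<open>Existence of the adjoint of the shift, which the description operator in
  \<^const>\<open>cadjoint\<close> takes for granted.\<close>

lemma cadjoint_shift: "cadjoint shift = backward_shift"
proof (rule cadjoint_eqI)
  fix x y :: "'a l2"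
  have "cinner (0::'a) z = 0" for z
    using cmod_cinner_le[of 0 z] by simp
  then show "cinner (shift x) y = cinner x (backward_shift y)"
    using suminf_split_head[OF summable_cinner_l2[of "shift x" y]]
    by (simp add: cinner_l2_def shift.rep_eq backward_shift.rep_eq)
qed

definition foguel :: "('e::complex_inner l2 \<Rightarrow> 'e l2) \<Rightarrow> nat \<Rightarrow> 'e l2 \<times> 'e l2 \<Rightarrow> 'e l2 \<times> 'e l2" where
  "foguel T n = block_op (cadjoint shift ^^ n) T (\<lambda>_. 0) (shift ^^ n)"

end

theory Submission
  imports Defs
begin

text \<open>The block operator with diagonal \<open>(V, W)\<close> and corner \<open>T\<close> behaves like the real matrix
  \<open>[1, t; 0, 1]\<close> with \<open>t = onorm T\<close>, whose norm \<open>l\<close> is the positive root of \<open>l\<^sup>2 = t * l + 1\<close> and is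
  attained at \<open>(1, l)\<close>. All that matters is that \<open>V\<close> is a contraction with an isometric right
  inverse \<open>J\<close> and that \<open>W\<close> is an isometry: the upper bound follows from the triangle inequality,
  and the lower bound from the vectors \<open>(J (T y) / (l * t), y)\<close>, for which \<open>V\<close> aligns the two
  summands of the first component. For the Foguel operator, \<open>J = W\<close> is the power of the shift.\<close>

lemma linear_block_op:
  assumes "linear A" "linear B" "linear C" "linear D"
  shows "linear (block_op A B C D)"
  using assms by (auto intro!: linearI simp: block_op_def linear_add linear_scale scaleR_add_right)

lemma onorm_upper_triangular_block:
  fixes V :: "'a::real_normed_vector \<Rightarrow> 'c::real_normed_vector"
    and T :: "'b::real_normed_vector \<Rightarrow> 'c"
    and W :: "'b \<Rightarrow> 'd::real_normed_vector"
  assumes nonzero: "\<exists>y::'b. y \<noteq> 0"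
    and T: "bounded_linear T"
    and V: "linear V" "\<And>x. norm (V x) \<le> norm x"
    and W: "linear W" "\<And>y. norm (W y) = norm y"
    and J: "\<And>z. V (J z) = z" "\<And>z. norm (J z) = norm z"
  shows "onorm (block_op V T (\<lambda>_. 0) W) = (onorm T + sqrt ((onorm T)\<^sup>2 + 4)) / 2"
proof -
  define R where "R = block_op V T (\<lambda>_. 0) W"
  define t where "t = onorm T"
  define l where "l = (t + sqrt (t\<^sup>2 + 4)) / 2"
  have t: "0 \<le> t"
    unfolding t_def using T by (rule onorm_pos_le)
  have l: "0 < l"
    unfolding l_def using t by (simp add: add_nonneg_pos)
  have l2: "l\<^sup>2 = t * l + 1"
  proof -
    have "(sqrt (t\<^sup>2 + 4))\<^sup>2 = t\<^sup>2 + 4"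
      by simp
    then show ?thesis
      unfolding l_def by (simp add: field_simps power2_eq_square)
  qed
  have R: "R (x, y) = (V x + T y, W y)" for x y
    by (simp add: R_def block_op_def)
  have "linear R"
    unfolding R_def using T V(1) W(1)
    by (intro linear_block_op) (auto simp: bounded_linear.linear module_hom_zero)
  have upper: "norm (R z) \<le> l * norm z" for z
  proof (cases z)
    case (Pair x y)
    define p q where "p = norm x" and "q = norm y"
    have "norm (V x + T y) \<le> p + t * q"
      using norm_triangle_le[of "V x" "T y"] V(2)[of x] onorm[OF T, of y]
      unfolding p_def q_def t_def by (simp add: add_mono)
    then have "(norm (V x + T y))\<^sup>2 + q\<^sup>2 \<le> (p + t * q)\<^sup>2 + q\<^sup>2"
      by (simp add: power_mono)
    also have "\<dots> \<le> l\<^sup>2 * (p\<^sup>2 + q\<^sup>2)"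
    proof -
      \<comment> \<open>The gap between the two sides, scaled by \<open>l\<close>, is
        \<open>t\<close> times a square; it vanishes at \<open>q = l * p\<close>, the extremal
        direction.\<close>
      have "l * (l\<^sup>2 * (p\<^sup>2 + q\<^sup>2) - ((p + t * q)\<^sup>2 + q\<^sup>2)) = t * (l * p - q)\<^sup>2"
        using l2 by algebra
      also have "\<dots> \<ge> 0"
        using t by simp
      finally show ?thesis
        using l by (simp add: zero_le_mult_iff)
    qed
    finally have "(norm (R z))\<^sup>2 \<le> (l * norm z)\<^sup>2"
      by (simp add: Pair R norm_Pair W(2) power_mult_distrib p_def q_def)
    then show ?thesis
      by (rule power2_le_imp_le) (use l in simp)
  qed
  \<comment> \<open>Boundedness makes \<open>onorm R\<close> an actual bound for \<open>R\<close>,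
    which the lower estimate tests on vectors.\<close>
  have "bounded_linear R"
    using \<open>linear R\<close> upper
    by (intro bounded_linear_intro[where K = l])
      (auto simp: linear_add linear_scale mult.commute)
  then have N: "norm (R z) \<le> onorm R * norm z" and N0: "0 \<le> onorm R" for z
    by (auto intro: onorm onorm_pos_le)
  have "l \<le> onorm R"
  proof (cases "t = 0")
    \<comment> \<open>Here \<open>l = 1\<close>, and the isometry \<open>W\<close> alone gives the
      bound; \<open>c\<close> below divides by \<open>t\<close>.\<close>
    case True
    obtain y :: 'b where "y \<noteq> 0"
      using nonzero by blast
    have "norm y \<le> norm (R (0, y))"
      by (metis R W(2) norm_snd_le snd_conv)
    also have "\<dots> \<le> onorm R * norm y"
      using N[of "(0, y)"] by (simp add: norm_Pair)
    finally show ?thesis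
      using \<open>y \<noteq> 0\<close> True by (simp add: l_def)
  next
    case False
    \<comment> \<open>This scaling gives \<open>norm (c *\<^sub>R J (T y)) \<le> norm y / l\<close>
      and \<open>(c + 1) * t = 1 / l + t = l\<close>.\<close>
    define c where "c = 1 / (l * t)"
    \<comment> \<open>The coefficient of \<open>(norm y)\<^sup>2\<close> that is left in the bound
      on \<open>(norm (R (x, y)))\<^sup>2\<close> after the contribution of \<open>W y\<close> is
      subtracted.\<close>
    define M where "M = (onorm R)\<^sup>2 * (1 + 1 / l\<^sup>2) - 1"
    have c: "0 < c"
      using False t l by (simp add: c_def)
    have key: "((c + 1) * norm (T y))\<^sup>2 \<le> M * (norm y)\<^sup>2" for y
    proof -
      define x where "x = c *\<^sub>R J (T y)"
      have "norm (T y) \<le> t * norm y"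
        unfolding t_def using T by (rule onorm)
      then have "norm x \<le> c * (t * norm y)"
        using c by (simp add: x_def J(2))
      also have "\<dots> = norm y / l"
        using False by (simp add: c_def)
      finally have x: "(norm x)\<^sup>2 \<le> (norm y)\<^sup>2 / l\<^sup>2"
        by (metis norm_ge_zero power_divide power_mono)
      have "V x + T y = (c + 1) *\<^sub>R T y"
        using V(1) by (simp add: x_def linear_scale J(1) scaleR_add_left)
      then have "((c + 1) * norm (T y))\<^sup>2 + (norm y)\<^sup>2 = (norm (R (x, y)))\<^sup>2"
        using c by (simp add: R norm_Pair W(2))
      also have "\<dots> \<le> (onorm R * norm (x, y))\<^sup>2"
        by (intro power_mono N) simp
      also have "\<dots> = (onorm R)\<^sup>2 * ((norm x)\<^sup>2 + (norm y)\<^sup>2)"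
        by (simp add: norm_Pair power_mult_distrib)
      also have "\<dots> \<le> (onorm R)\<^sup>2 * ((norm y)\<^sup>2 / l\<^sup>2 + (norm y)\<^sup>2)"
        using x by (intro mult_left_mono) auto
      finally show ?thesis
        by (simp add: M_def algebra_simps)
    qed
    \<comment> \<open>Ensures that \<open>sqrt M\<close> is nonnegative and squares back to
      \<open>M\<close>.\<close>
    have M: "0 \<le> M"
    proof -
      obtain y :: 'b where "y \<noteq> 0"
        using nonzero by blast
      have "0 \<le> M * (norm y)\<^sup>2"
        using key[of y] by (meson order_trans zero_le_power2)
      then show ?thesis
        using \<open>y \<noteq> 0\<close> by (simp add: zero_le_mult_iff)
    qed
    \<comment> \<open>Since \<open>key\<close> holds for every \<open>y\<close>, it bounds the
      operator norm of \<open>T\<close> directly, whether or not that norm is attained.\<close>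
    have "t \<le> sqrt M / (c + 1)"
      unfolding t_def
    proof (rule onorm_bound)
      show "norm (T y) \<le> sqrt M / (c + 1) * norm y" for y
        using real_le_rsqrt[OF key[of y]] c M
        by (simp add: real_sqrt_mult field_simps)
    qed (use c M in simp)
    then have "(c + 1) * t \<le> sqrt M"
      using c by (simp add: field_simps)
    moreover have "(c + 1) * t = l"
    proof -
      have "l * ((c + 1) * t) = l * l"
        using False l l2 by (simp add: c_def distrib_left distrib_right power2_eq_square mult.commute)
      then show ?thesis
        using l by simp
    qed
    ultimately have "l\<^sup>2 \<le> M"
      using l M by (metis less_imp_le power_mono real_sqrt_pow2)
    \<comment> \<open>By definition
      \<open>l\<^sup>2 * (M + 1) = (l\<^sup>2 + 1) * (onorm R)\<^sup>2\<close>, so a common positive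
      factor appears and cancels next.\<close>
    then have "(l\<^sup>2 + 1) * l\<^sup>2 \<le> (l\<^sup>2 + 1) * (onorm R)\<^sup>2"
      using l by (simp add: M_def field_simps)
    then have "l\<^sup>2 \<le> (onorm R)\<^sup>2"
      by (simp add: add_nonneg_pos mult_le_cancel_left_pos)
    then show ?thesis
      using N0 by (rule power2_le_imp_le)
  qed
  moreover have "onorm R \<le> l"
    using l upper by (intro onorm_bound) auto
  ultimately show ?thesis
    by (simp add: R_def l_def t_def)
qed

lemma linear_shift: "linear shift"
  by (rule linearI; rule l2_eqI)
    (simp_all add: shift.rep_eq plus_l2.rep_eq scaleR_l2.rep_eq split: nat.split)

lemma linear_backward_shift: "linear backward_shift"
  by (rule linearI; rule l2_eqI)
    (simp_all add: backward_shift.rep_eq plus_l2.rep_eq scaleR_l2.rep_eq)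

lemma norm_shift: "norm (shift a) = norm a"
  using suminf_split_head[OF summable_l2[of "shift a"]]
  by (simp add: norm_l2_def shift.rep_eq)

text \<open>Only the nonnegative head term of the series is lost.\<close>

lemma norm_backward_shift_le: "norm (backward_shift a) \<le> norm a"
  using suminf_split_head[OF summable_l2[of a]]
  by (simp add: norm_l2_def backward_shift.rep_eq)

lemma backward_shift_shift: "backward_shift (shift a) = a"
  by (rule l2_eqI) (simp add: shift.rep_eq backward_shift.rep_eq)

lemma linear_funpow:
  fixes f :: "'a::real_vector \<Rightarrow> 'a"
  shows "linear f \<Longrightarrow> linear (f ^^ n)"
  by (induction n) (auto intro: linearI linear_compose)

lemma norm_funpow_shift: "norm ((shift ^^ n) a) = norm a"
  by (induction n) (simp_all add: norm_shift)

lemma norm_funpow_backward_shift_le: "norm ((backward_shift ^^ n) a) \<le> norm a"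
  by (induction n) (auto intro: order_trans[OF norm_backward_shift_le])

lemma funpow_backward_shift_shift: "(backward_shift ^^ n) ((shift ^^ n) a) = a"
proof (induction n arbitrary: a)
  case (Suc n)
  \<comment> \<open>Regrouping brings one backward shift next to one shift in the middle, where they
    cancel.\<close>
  have "(backward_shift ^^ Suc n) ((shift ^^ Suc n) a)
      = (backward_shift ^^ n) (backward_shift (shift ((shift ^^ n) a)))"
    by (simp add: funpow_swap1)
  then show ?case
    by (simp add: backward_shift_shift Suc.IH)
qed simp

text \<open>Rules out the zero space, where \<open>onorm\<close> is 0 but the formula gives 1. The
  witness is \<open>(e, 0, 0, ...)\<close>.\<close>

lemma exists_nonzero_l2:
  assumes "\<exists>e::'e::complex_inner. e \<noteq> 0"
  shows "\<exists>a::'e l2. a \<noteq> 0"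
proof -
  obtain e :: 'e where "e \<noteq> 0"
    using assms by blast
  have "summable (\<lambda>k. (norm (if k = 0 then e else 0))\<^sup>2)"
    by (rule summable_finite[of "{0::nat}"]) auto
  then have "l2_nth (Abs_l2 (\<lambda>k. if k = 0 then e else 0)) 0 \<noteq> l2_nth 0 0"
    using \<open>e \<noteq> 0\<close> by (simp add: Abs_l2_inverse zero_l2.rep_eq)
  then show ?thesis
    by metis
qed

theorem corollary2:
  fixes T :: "'e::chilbert_space l2 \<Rightarrow> 'e l2" and n :: nat
  assumes "\<exists>e::'e. e \<noteq> 0"
    and "separable_space (euclidean :: 'e topology)"
    and "bounded_clinear T"
  shows "onorm (foguel T n) = (onorm T + sqrt ((onorm T)\<^sup>2 + 4)) / 2"
  unfolding foguel_def cadjoint_shift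
\<comment> \<open>After the adjoint is rewritten, \<open>V\<close> is
  \<open>backward_shift ^^ n\<close>, a left inverse of \<open>shift ^^ n\<close>.\<close>
proof (rule onorm_upper_triangular_block[where J = "shift ^^ n"])
  show "bounded_linear T"
    using assms(3) by (simp add: bounded_clinear_def)
qed (simp_all add: exists_nonzero_l2[OF assms(1)] linear_funpow linear_shift linear_backward_shift
    norm_funpow_shift norm_funpow_backward_shift_le funpow_backward_shift_shift)

end
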